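(* Let $n\ge1$. Let $f\in\ell^2(\mathbb{Z}^n)$ with $f\neq0$, let $g\in\ell^2(\mathbb{Z}^n)$ be a non-zero window function, let $\Sigma\subset\mathbb{Z}^n\times\mathbb{T}^n$ be measurable with $(\nu\otimes\mu)(\Sigma)<\infty$, and let $0\le\varepsilon_\Sigma<1$. If $V_gf$ is $\varepsilon_\Sigma$-time-frequency concentrated on $\Sigma$, then for every (real) $p>2$, $$(\nu\otimes\mu)(\Sigma)\ge(1-\varepsilon_\Sigma^2)^{\frac{p}{p-2}}.$$
   Context: For $f,g\in\ell^2(\mathbb{Z}^n)$ the short-time Fourier transform (STFT) of $f$ with window $g$ is the function on $\mathbb{Z}^n\times\mathbb{T}^n$ (where $\mathbb{T}^n=\mathbb{R}^n/\mathbb{Z}^n$) given by $V_gf(m,w)=\sum_{k\in\mathbb{Z}^n}f(k)\,\overline{g(k-m)}\,e^{-2\pi i w\cdot k}$. The measure $\nu\otimes\mu$ on $\mathbb{Z}^n\times\mathbb{T}^n$ is the product of the counting measure $\nu$ on $\mathbb{Z}^n$ and the Lebesgue measure $\mu$ on $\mathbb{T}^n$ (total mass $1$); $L^2(\mathbb{Z}^n\times\mathbb{T}^n)$ is taken with respect to $\nu\otimes\mu$. For a measurable $\Sigma\subset\mathbb{Z}^n\times\mathbb{T}^n$ and $0\le\varepsilon_\Sigma<1$, $V_gf$ is called $\varepsilon_\Sigma$-time-frequency concentrated on $\Sigma$ if $\|\chi_{\Sigma^c}V_gf\|_{L^2(\mathbb{Z}^n\times\mathbb{T}^n)}\le\varepsilon_\Sigma\|V_gf\|_{L^2(\mathbb{Z}^n\times\mathbb{T}^n)}$,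 where $\chi_{\Sigma^c}$ is the characteristic function of the complement of $\Sigma$. *)

theory Defs
  imports "HOL-Analysis.Analysis"
begin

text \<open>The lattice \<open>\<int>\<^sup>n\<close> is the type \<open>int ^ 'n\<close>.  The torus \<open>\<real>\<^sup>n / \<int>\<^sup>n\<close> is represented by its
  fundamental domain \<open>[0,1)\<^sup>n\<close>; all functions of the torus variable below are \<open>\<int>\<^sup>n\<close>-periodic
  (see \<open>stft_periodic\<close>).\<close>

definition l2 :: "('a \<Rightarrow> complex) set"
  where "l2 = {f. (\<lambda>k. (cmod (f k))\<^sup>2) summable_on UNIV}"

definition lattice_dot :: "real ^ 'n \<Rightarrow> int ^ 'n \<Rightarrow> real"
  where "lattice_dot w k = (\<Sum>i\<in>UNIV. w $ i * real_of_int (k $ i))"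

definition stft :: "(int ^ 'n \<Rightarrow> complex) \<Rightarrow> (int ^ 'n \<Rightarrow> complex) \<Rightarrow> (int ^ 'n) \<times> (real ^ 'n) \<Rightarrow> complex"
  where "stft g f = (\<lambda>(m, w).
    \<Sum>\<^sub>\<infinity>k. f k * cnj (g (k - m)) * exp (- 2 * of_real pi * \<i> * of_real (lattice_dot w k)))"

definition torus_measure :: "(real ^ 'n) measure"
  where "torus_measure = lebesgue_on {w. \<forall>i. 0 \<le> w $ i \<and> w $ i < 1}"

text \<open>Since the first factor is countable and discrete, this product is already complete: its
  measurable sets are those whose slices at every lattice point are Lebesgue measurable.\<close>

definition tf_measure :: "((int ^ 'n) \<times> (real ^ 'n)) measure"
  where "tf_measure = count_space UNIV \<Otimes>\<^sub>M torus_measure"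

text \<open>Meaningful for square-integrable \<open>F\<close> only (the Bochner integral is 0 otherwise).  It is
  applied to \<open>stft g f\<close> and its restrictions, which are square-integrable for
  \<open>f\<close>, \<open>g\<close> in \<open>l2\<close> by the orthogonality relation.\<close>

definition L2_norm :: "'a measure \<Rightarrow> ('a \<Rightarrow> complex) \<Rightarrow> real"
  where "L2_norm M F = sqrt (LINT x|M. (cmod (F x))\<^sup>2)"

definition tf_concentrated ::
    "real \<Rightarrow> ((int ^ 'n) \<times> (real ^ 'n)) set \<Rightarrow> ((int ^ 'n) \<times> (real ^ 'n) \<Rightarrow> complex) \<Rightarrow> bool"
  where "tf_concentrated \<epsilon> \<Sigma> F \<longleftrightarrow>
    L2_norm tf_measure (\<lambda>x. indicator (space tf_measure - \<Sigma>) x * F x) \<le> \<epsilon> * L2_norm tf_measure F"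

lemma stft_periodic: "stft g f (m, w + (\<chi> i. real_of_int (l $ i))) = stft g f (m, w)"
proof -
  have "exp (- 2 * of_real pi * \<i> * of_real (lattice_dot (w + (\<chi> i. real_of_int (l $ i))) k))
      = exp (- 2 * of_real pi * \<i> * complex_of_real (lattice_dot w k))" for k
  proof -
    define N where "N = (\<Sum>i\<in>UNIV. l $ i * k $ i)"
    have "lattice_dot (w + (\<chi> i. real_of_int (l $ i))) k = lattice_dot w k + real_of_int N"
      by (simp add: lattice_dot_def N_def sum.distrib distrib_right)
    then show ?thesis
      unfolding exp_eq by (intro exI[of _ "- N"]) (simp add: algebra_simps)
  qed
  then show ?thesis
    by (simp add: stft_def)
qed

end

theory Submission
  imports Defs
begin

text \<open>The pointwise bound \<open>\<bar>V\<^sub>g f\<bar>\<^sup>2 \<le> A\<close> with \<open>A = \<parallel>f\<parallel>\<^sup>2 \<parallel>g\<parallel>\<^sup>2\<close> and the orthogonality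
  relation \<open>\<parallel>V\<^sub>g f\<parallel>\<^sup>2 = A\<close> (Parseval on the torus, then summation over the lattice) give
  \<open>(1 - \<epsilon>\<^sup>2) A \<le> \<integral>\<^sub>\<Sigma> \<bar>V\<^sub>g f\<bar>\<^sup>2 \<le> A |\<Sigma>|\<close>.  So \<open>|\<Sigma>| \<ge> 1 - \<epsilon>\<^sup>2\<close>, which is stronger than the claim,
  since \<open>p / (p - 2) \<ge> 1\<close>.\<close>

section \<open>Characters of the torus and their integrals\<close>

definition torus_char :: "int ^ 'n \<Rightarrow> real ^ 'n \<Rightarrow> complex"
  where "torus_char k w = exp (- 2 * of_real pi * \<i> * of_real (lattice_dot w k))"

lemma stft_torus_char:
  "stft g f (m, w) = (\<Sum>\<^sub>\<infinity>k. f k * cnj (g (k - m)) * torus_char k w)"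
  by (simp add: stft_def torus_char_def)

lemma norm_torus_char [simp]: "cmod (torus_char k w) = 1"
  by (simp add: torus_char_def norm_exp_eq_Re)

text \<open>Orthogonality of two characters thereby reduces to the integral of a single one,
  computed in \<open>integral_torus_char\<close>.\<close>

lemma torus_char_mult_cnj: "torus_char k w * cnj (torus_char l w) = torus_char (k - l) w"
  by (simp add: torus_char_def lattice_dot_def exp_cnj algebra_simps sum_subtractf flip: exp_add)

lemma continuous_torus_char: "continuous_on A (torus_char k)"
  unfolding torus_char_def lattice_dot_def by (intro continuous_intros)

text \<open>In this form the indicator of the torus is a product over the basis vectors, so it
  factors together with the characters in \<open>integral_torus_char\<close>.\<close>

lemma torus_eq_Basis:
  "{w :: real ^ 'n. \<forall>i. 0 \<le> w $ i \<and> w $ i < 1} = {w. \<forall>b\<in>Basis. w \<bullet> b \<in> {0..<1}}"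
  by (auto simp: Basis_vec_def inner_axis)

lemma torus_borel [measurable]: "{w :: real ^ 'n. \<forall>i. 0 \<le> w $ i \<and> w $ i < 1} \<in> sets borel"
  unfolding torus_eq_Basis by measurable

lemma torus_char_measurable [measurable]: "torus_char k \<in> borel_measurable torus_measure"
proof -
  have "torus_char k \<in> borel_measurable borel"
    by (rule borel_measurable_continuous_onI[OF continuous_torus_char])
  then show ?thesis
    unfolding torus_measure_def
    by (intro measurable_restrict_space1 measurable_completion) simp
qed

text \<open>For nonzero \<open>n\<close> the exponential has an antiderivative of period 1, so its
  values at 0 and 1 cancel.\<close>

lemma integral_unit_interval_exp:
  "(LINT t|lborel. of_real (indicator {0..<1} t) * exp (- 2 * of_real pi * \<i> * of_real (t * of_int n)))
    = (if n = 0 then 1 else (0 :: complex))"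
proof -
  let ?e = "\<lambda>t::real. exp (- 2 * of_real pi * \<i> * of_real (t * of_int n)) :: complex"
  \<comment> \<open>The fundamental theorem of calculus is applied on a closed interval; adding the
    endpoint 1 changes the integrand only on a null set.\<close>
  have "(LINT t|lborel. of_real (indicator {0..<1} t) * ?e t) = (LINT t|lborel. indicator {0..1} t *\<^sub>R ?e t)"
  proof (rule integral_cong_AE)
    show "AE t in lborel. of_real (indicator {0..<1} t) * ?e t = indicator {0..1} t *\<^sub>R ?e t"
      using AE_lborel_singleton[of 1]
      by eventually_elim (auto simp: indicator_def)
  qed measurable
  also have "\<dots> = (if n = 0 then 1 else 0)"
  proof (cases "n = 0")
    case True
    then show ?thesis by simp
  next
    case False
    let ?c = "- 2 * of_real pi * \<i> * of_int n :: complex"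
    have c: "?c \<noteq> 0" using False by simp
    have eq: "?e t = exp (?c * of_real t)" for t by (simp add: mult_ac)
    have "(LINT t|lborel. indicator {0..1} t *\<^sub>R ?e t) = exp (?c * of_real 1) / ?c - exp (?c * of_real 0) / ?c"
      unfolding eq
    proof (rule integral_FTC_atLeastAtMost)
      fix x :: real
      have "((\<lambda>z. exp (?c * z) / ?c) has_field_derivative exp (?c * of_real x)) (at (of_real x))"
        using c by (auto intro!: derivative_eq_intros)
      from has_vector_derivative_real_field[OF this]
      show "((\<lambda>x. exp (?c * of_real x) / ?c) has_vector_derivative exp (?c * of_real x)) (at x within {0..1})" .
    qed (auto intro!: continuous_intros)
    also have "exp (?c * of_real 1) = 1"
      unfolding exp_eq_1 by (auto intro!: exI[of _ "- n"])
    finally show ?thesis using False by simp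
  qed
  finally show ?thesis .
qed

text \<open>Lebesgue measure is the image of the product of one-dimensional Lebesgue measures under
  the coordinate map, so Fubini for finite products splits the integral.\<close>

lemma integral_lborel_prod_Basis:
  fixes F :: "'a::euclidean_space \<Rightarrow> real \<Rightarrow> complex"
  assumes F: "\<And>b. b \<in> Basis \<Longrightarrow> integrable lborel (F b)"
  shows "(LINT x|lborel. (\<Prod>b\<in>Basis. F b (x \<bullet> b))) = (\<Prod>b\<in>Basis. LINT t|lborel. F b t)"
proof -
  interpret product_sigma_finite "\<lambda>_. lborel :: real measure" ..
  have [measurable]: "F b \<in> borel_measurable borel" if "b \<in> Basis" for b
    using F[OF that] by (simp add: integrable_iff_bounded)
  have m: "(\<lambda>f. \<Sum>b\<in>Basis. f b *\<^sub>R b) \<in> (\<Pi>\<^sub>M b\<in>Basis. lborel) \<rightarrow>\<^sub>M (borel :: 'a measure)"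
    by measurable
  have "(LINT x|lborel. (\<Prod>b\<in>Basis. F b (x \<bullet> b)))
      = (LINT f|(\<Pi>\<^sub>M b\<in>Basis. lborel). (\<Prod>b\<in>Basis. F b ((\<Sum>c\<in>Basis. f c *\<^sub>R c) \<bullet> b)))"
    by (subst lborel_eq, subst integral_distr[OF m]) auto
  also have "\<dots> = (LINT f|(\<Pi>\<^sub>M b\<in>Basis. lborel). (\<Prod>b\<in>Basis. F b (f b)))"
    by (intro Bochner_Integration.integral_cong prod.cong refl) simp
  also have "\<dots> = (\<Prod>b\<in>Basis. LINT t|lborel. F b t)"
    by (rule product_integral_prod[OF finite_Basis F])
  finally show ?thesis .
qed

text \<open>The character and the indicator of the torus both factor over the coordinates. Each
  factor integrates to 1 or 0, and a single nonzero coordinate of \<open>k\<close> makes the product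
  vanish.\<close>

lemma integral_torus_char:
  fixes k :: "int ^ 'n"
  shows "(LINT w|torus_measure. torus_char k w) = (if k = 0 then 1 else 0)"
proof -
  let ?S = "{w :: real ^ 'n. \<forall>i. 0 \<le> w $ i \<and> w $ i < 1}"
  \<comment> \<open>Viewing the frequency as a real vector turns \<open>lattice_dot w k\<close> into
    an inner product, which can be expanded in \<open>Basis\<close>; the coordinates of
    \<open>?K\<close> remain integers.\<close>
  let ?K = "\<chi> i. real_of_int (k $ i)"
  let ?F = "\<lambda>b t. of_real (indicator {0..<1} t) * exp (- 2 * of_real pi * \<i> * of_real (t * (?K \<bullet> b))) :: complex"
  have dot: "lattice_dot w k = (\<Sum>b\<in>Basis. (w \<bullet> b) * (?K \<bullet> b))" for w :: "real ^ 'n"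
    unfolding lattice_dot_def by (subst euclidean_inner[symmetric]) (simp add: inner_vec_def)
  have ind: "indicator ?S w = (\<Prod>b\<in>Basis. indicator {0..<1} (w \<bullet> b) :: real)" for w
    unfolding torus_eq_Basis by (auto simp: indicator_def prod_zero_iff)
  have Kb: "\<exists>n. ?K \<bullet> b = of_int n" if "b \<in> Basis" for b
    using that by (auto simp: Basis_vec_def inner_axis)
  have int1: "(LINT t|lborel. ?F b t) = (if ?K \<bullet> b = 0 then 1 else 0)" if "b \<in> Basis" for b
  proof -
    obtain n where n: "?K \<bullet> b = of_int n"
      using Kb[OF \<open>b \<in> Basis\<close>] by blast
    show ?thesis
      unfolding n using integral_unit_interval_exp[of n] by (simp only: of_int_eq_0_iff)
  qed
  \<comment> \<open>The integrand is Borel, so the completed measure may be replaced by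
    \<open>lborel\<close>, to which the product formula applies.\<close>
  have "(LINT w|torus_measure. torus_char k w) = (LINT w|lborel. indicator ?S w *\<^sub>R torus_char k w)"
    unfolding torus_measure_def
    by (subst integral_restrict_space)
       (auto intro!: integral_completion borel_measurable_scaleR borel_measurable_indicator
          borel_measurable_continuous_onI continuous_torus_char)
  also have "\<dots> = (LINT w|lborel. (\<Prod>b\<in>Basis. ?F b (w \<bullet> b)))"
    by (intro Bochner_Integration.integral_cong refl)
       (simp add: ind torus_char_def dot prod.distrib scaleR_conv_of_real sum_distrib_left exp_sum)
  also have "\<dots> = (\<Prod>b\<in>Basis. LINT t|lborel. ?F b t)"
  proof (rule integral_lborel_prod_Basis)
    fix b :: "real ^ 'n"
    have "set_integrable lborel {0..<1::real} (\<lambda>_. 1 :: real)"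
      by (simp add: set_integrable_def)
    then show "integrable lborel (?F b)"
      unfolding set_integrable_def
      by (rule Bochner_Integration.integrable_bound) (auto simp: norm_mult norm_exp_eq_Re)
  qed
  also have "\<dots> = (\<Prod>b\<in>Basis. if ?K \<bullet> b = 0 then 1 else 0)"
    by (intro prod.cong refl int1)
  also have "\<dots> = (if k = 0 then 1 else 0)"
  proof -
    have "(\<forall>b\<in>Basis. ?K \<bullet> b = 0) \<longleftrightarrow> k = 0"
      by (auto simp: Basis_vec_def inner_axis vec_eq_iff)
    then show ?thesis by (auto simp: prod_zero_iff)
  qed
  finally show ?thesis .
qed

section \<open>Interchange of sum and integral, and Parseval on the torus\<close>

lemma finite_measure_torus: "finite_measure torus_measure"
proof -
  let ?S = "{w :: real ^ 'n. \<forall>i. 0 \<le> w $ i \<and> w $ i < 1}"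
  have "bounded ?S"
    by (rule bounded_subset[OF bounded_cbox[of 0 1]]) (auto simp: mem_box_cart less_imp_le)
  moreover have "?S \<in> sets lebesgue" by (simp add: sets_completionI_sets)
  ultimately show ?thesis
    unfolding torus_measure_def by (intro finite_measure_lebesgue_on bounded_set_imp_lmeasurable)
qed

text \<open>Fubini applies because \<open>h k * G k x\<close> is dominated by
  \<open>B * cmod (h k)\<close>, which is integrable over the product with a finite measure.\<close>

lemma (in finite_measure) integral_sum_swap:
  fixes h :: "'b::countable \<Rightarrow> complex" and G :: "'b \<Rightarrow> 'a \<Rightarrow> complex"
  assumes h: "integrable (count_space UNIV) h"
    and G [measurable]: "\<And>k. G k \<in> borel_measurable M"
    and bound: "\<And>k x. x \<in> space M \<Longrightarrow> cmod (G k x) \<le> B"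
  shows "(LINT x|M. LINT k|count_space UNIV. h k * G k x) = (LINT k|count_space UNIV. h k * (LINT x|M. G k x))"
proof -
  interpret C: sigma_finite_measure "count_space UNIV :: 'b measure"
    by (rule sigma_finite_measure_count_space)
  interpret P: pair_sigma_finite "count_space UNIV :: 'b measure" M ..
  have intG: "integrable M (G k)" for k
    by (rule integrable_const_bound[where B = B]) (auto simp: bound)
  \<comment> \<open>The index type is countable, so measurability of every slice gives joint
    measurability.\<close>
  have [measurable]: "(\<lambda>(k, x). h k * G k x) \<in> borel_measurable (count_space UNIV \<Otimes>\<^sub>M M)"
    by (rule measurable_pair_measure_countable1) auto
  have "integrable (count_space UNIV \<Otimes>\<^sub>M M) (\<lambda>(k, x). h k * G k x)"
  proof (rule P.Fubini_integrable)
    have "integrable (count_space UNIV) (\<lambda>k. (LINT x|M. B) * cmod (h k))"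
      using h by simp
    then show "integrable (count_space UNIV) (\<lambda>k. LINT x|M. norm (case (k, x) of (k, x) \<Rightarrow> h k * G k x))"
    proof (rule Bochner_Integration.integrable_bound)
      have "(LINT x|M. cmod (G k x)) \<le> (LINT x|M. B)" for k
        using intG by (intro integral_mono) (auto simp: bound)
      then have le: "cmod (h k) * (LINT x|M. cmod (G k x)) \<le> (LINT x|M. B) * cmod (h k)" for k
        by (metis mult.commute mult_left_mono norm_ge_zero)
      have eq: "norm (LINT x|M. norm (case (k, x) of (k, x) \<Rightarrow> h k * G k x))
          = cmod (h k) * (LINT x|M. cmod (G k x))" for k
        by (simp add: norm_mult abs_mult)
      show "AE k in count_space UNIV.
          norm (LINT x|M. norm (case (k, x) of (k, x) \<Rightarrow> h k * G k x)) \<le> norm ((LINT x|M. B) * cmod (h k))"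
        unfolding eq unfolding real_norm_def by (intro AE_I2 order_trans[OF le abs_ge_self])
    qed simp
    show "AE k in count_space UNIV. integrable M (\<lambda>x. case (k, x) of (k, x) \<Rightarrow> h k * G k x)"
      using intG by simp
  qed simp
  from P.Fubini_integral[OF this] show ?thesis by simp
qed

lemma borel_measurable_cnj [measurable]:
  assumes "f \<in> borel_measurable M"
  shows "(\<lambda>x. cnj (f x)) \<in> borel_measurable M"
  using assms by (rule measurable_compose) (intro borel_measurable_continuous_onI continuous_intros)

text \<open>Expand one factor of \<open>F w * cnj (F w)\<close> and integrate term by term: what
  remains beside \<open>h k\<close> is its conjugate, by orthogonality of the characters. Absolute
  summability of \<open>h\<close> justifies the interchanges. The nonnegative form of the identity
  can then be summed over the lattice in \<open>stft_orthogonality\<close>.\<close>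

lemma parseval_torus:
  fixes h :: "int ^ 'n \<Rightarrow> complex"
  assumes h: "integrable (count_space UNIV) h"
  defines "F \<equiv> \<lambda>w. LINT k|count_space UNIV. h k * torus_char k w"
  shows "F \<in> borel_measurable torus_measure"
    and "(\<integral>\<^sup>+w. ennreal ((cmod (F w))\<^sup>2) \<partial>torus_measure) = (\<integral>\<^sup>+k. ennreal ((cmod (h k))\<^sup>2) \<partial>count_space UNIV)"
proof -
  interpret T: finite_measure "torus_measure :: (real ^ 'n) measure" by (rule finite_measure_torus)
  interpret C: sigma_finite_measure "count_space UNIV :: (int ^ 'n) measure"
    by (rule sigma_finite_measure_count_space)
  let ?C = "count_space UNIV :: (int ^ 'n) measure"
  have "(\<lambda>(k, w). h k * torus_char k w) \<in> borel_measurable (?C \<Otimes>\<^sub>M torus_measure)"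
    by (rule measurable_pair_measure_countable1) auto
  from measurable_compose[OF measurable_pair_swap' this]
  show F [measurable]: "F \<in> borel_measurable torus_measure"
    unfolding F_def by (intro C.borel_measurable_lebesgue_integral) (simp add: case_prod_beta)
  \<comment> \<open>This uniform bound by the sum of the moduli serves twice: as the constant
    \<open>B\<close> in the interchange for \<open>F w * cnj (F w)\<close>, and for square
    integrability of \<open>F\<close>.\<close>
  have bound: "cmod (F w) \<le> (LINT k|?C. cmod (h k))" for w
    unfolding F_def by (rule order_trans[OF integral_norm_bound]) (simp add: norm_mult)
  \<comment> \<open>This is the conjugate of the Fourier coefficient of \<open>F\<close> at
    \<open>k\<close>. After expanding \<open>cnj (F w)\<close>, only the term \<open>l = k\<close>
    survives.\<close>
  have coeff: "(LINT w|torus_measure. torus_char k w * cnj (F w)) = cnj (h k)" for k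
  proof -
    have "(LINT w|torus_measure. torus_char k w * cnj (F w))
        = (LINT w|torus_measure. LINT l|?C. cnj (h l) * torus_char (k - l) w)"
      unfolding F_def Bochner_Integration.integral_cnj[symmetric] integral_mult_right_zero[symmetric]
      by (simp add: torus_char_mult_cnj[symmetric] mult_ac)
    also have "\<dots> = (LINT l|?C. cnj (h l) * (LINT w|torus_measure. torus_char (k - l) w))"
      using h by (intro T.integral_sum_swap[where B = 1]) auto
    also have "\<dots> = (LINT l|?C. (if l = k then cnj (h k) else 0))"
      by (intro Bochner_Integration.integral_cong refl) (auto simp: integral_torus_char)
    also have "\<dots> = (LINT l|?C. indicator {k} l *\<^sub>R cnj (h k))"
      by (intro Bochner_Integration.integral_cong refl) (auto simp: indicator_def)
    also have "\<dots> = cnj (h k)"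
      by simp
    finally show ?thesis .
  qed
  have "of_real (LINT w|torus_measure. (cmod (F w))\<^sup>2) = (LINT w|torus_measure. F w * cnj (F w))"
    unfolding integral_complex_of_real[symmetric] by (simp only: complex_norm_square)
  also have "\<dots> = (LINT w|torus_measure. LINT k|?C. h k * (torus_char k w * cnj (F w)))"
  proof (intro Bochner_Integration.integral_cong refl)
    fix w
    have "F w * cnj (F w) = (LINT k|?C. h k * torus_char k w * cnj (F w))"
      unfolding integral_mult_left_zero by (simp only: F_def)
    then show "F w * cnj (F w) = (LINT k|?C. h k * (torus_char k w * cnj (F w)))"
      by (simp only: mult.assoc)
  qed
  also have "\<dots> = (LINT k|?C. h k * (LINT w|torus_measure. torus_char k w * cnj (F w)))"
    using h bound
    by (intro T.integral_sum_swap[where B = "LINT k|?C. cmod (h k)"]) (auto simp: norm_mult)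
  also have "\<dots> = of_real (LINT k|?C. (cmod (h k))\<^sup>2)"
    unfolding coeff integral_complex_of_real[symmetric] by (simp only: complex_norm_square)
  finally have eq: "(LINT w|torus_measure. (cmod (F w))\<^sup>2) = (LINT k|?C. (cmod (h k))\<^sup>2)"
    by (simp only: of_real_eq_iff)
  have intF: "integrable torus_measure (\<lambda>w. (cmod (F w))\<^sup>2)"
    using bound by (intro T.integrable_const_bound[where B = "(LINT k|?C. cmod (h k))\<^sup>2"])
      (auto intro!: power_mono)
  \<comment> \<open>Passing from \<open>eq\<close> to nonnegative integrals requires integrability
    on both sides, since Bochner integrals default to 0. On the lattice side it follows because each
    term is at most the sum of all moduli, so the squares are dominated by a multiple of the
    moduli.\<close>
  have "cmod (h k) \<le> (LINT k|?C. cmod (h k))" for k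
  proof -
    have "(LINT l|?C. indicator {k} l *\<^sub>R cmod (h k)) \<le> (LINT l|?C. cmod (h l))"
      using h
      by (intro integral_mono Bochner_Integration.integrable_scaleR_left integrable_real_indicator)
         (auto simp: indicator_def)
    then show ?thesis by simp
  qed
  then have "(cmod (h k))\<^sup>2 \<le> (LINT k|?C. cmod (h k)) * cmod (h k)" for k
    unfolding power2_eq_square by (rule mult_right_mono) simp
  then have le: "norm ((cmod (h k))\<^sup>2) \<le> norm ((LINT k|?C. cmod (h k)) * cmod (h k))" for k
    unfolding real_norm_def abs_power2 by (rule order_trans[OF _ abs_ge_self])
  have "integrable ?C (\<lambda>k. (LINT k|?C. cmod (h k)) * cmod (h k))"
    using h by simp
  then have "integrable ?C (\<lambda>k. (cmod (h k))\<^sup>2)"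
    by (rule Bochner_Integration.integrable_bound) (simp, intro AE_I2 le)
  then show "(\<integral>\<^sup>+w. ennreal ((cmod (F w))\<^sup>2) \<partial>torus_measure) = (\<integral>\<^sup>+k. ennreal ((cmod (h k))\<^sup>2) \<partial>?C)"
    using intF eq by (simp add: nn_integral_eq_integral)
qed

section \<open>Square-summable sequences as integrals over counting measure\<close>

lemma l2_integrable: "f \<in> l2 \<longleftrightarrow> integrable (count_space UNIV) (\<lambda>k. (cmod (f k))\<^sup>2)"
  using abs_summable_equivalent[of "\<lambda>k. (cmod (f k))\<^sup>2" UNIV]
  by (simp add: l2_def abs_summable_on_def)

lemma l2_integral_pos:
  assumes "f \<in> l2" "f \<noteq> (\<lambda>_. 0)"
  shows "0 < (LINT k|count_space UNIV. (cmod (f k))\<^sup>2)"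
proof -
  have "(LINT k|count_space UNIV. (cmod (f k))\<^sup>2) \<noteq> 0"
    using assms by (subst integral_nonneg_eq_0_iff_AE) (auto simp: l2_integrable AE_count_space)
  then show ?thesis
    by (simp add: order_less_le integral_nonneg)
qed

lemma l2_shift:
  fixes g :: "'a::ab_group_add \<Rightarrow> complex"
  shows "(\<lambda>k. g (k - m)) \<in> l2 \<longleftrightarrow> g \<in> l2"
    and "(LINT k|count_space UNIV. (cmod (g (k - m)))\<^sup>2) = (LINT k|count_space UNIV. (cmod (g k))\<^sup>2)"
proof -
  have bij: "bij_betw (\<lambda>k. k - m) UNIV UNIV"
    by (rule bij_betw_byWitness[where f' = "\<lambda>k. k + m"]) auto
  show "(\<lambda>k. g (k - m)) \<in> l2 \<longleftrightarrow> g \<in> l2"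
    unfolding l2_integrable by (rule integrable_bij_count_space[OF bij])
  show "(LINT k|count_space UNIV. (cmod (g (k - m)))\<^sup>2) = (LINT k|count_space UNIV. (cmod (g k))\<^sup>2)"
    by (rule integral_bij_count_space[OF bij])
qed

text \<open>A weighted arithmetic-geometric mean inequality is summed term by term. The moduli stand
  inside the sum because \<open>stft_bound\<close> starts from the triangle inequality.\<close>

lemma l2_Cauchy_Schwarz:
  assumes f: "f \<in> l2" "f \<noteq> (\<lambda>_. 0)" and g: "g \<in> l2" "g \<noteq> (\<lambda>_. 0)"
  shows "integrable (count_space UNIV) (\<lambda>k. f k * cnj (g k))"
    and "(LINT k|count_space UNIV. cmod (f k * cnj (g k)))\<^sup>2
      \<le> (LINT k|count_space UNIV. (cmod (f k))\<^sup>2) * (LINT k|count_space UNIV. (cmod (g k))\<^sup>2)"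
proof -
  define a b where "a = sqrt (LINT k|count_space UNIV. (cmod (f k))\<^sup>2)"
    and "b = sqrt (LINT k|count_space UNIV. (cmod (g k))\<^sup>2)"
  have pos: "0 < a" "0 < b"
    using l2_integral_pos f g by (simp_all add: a_def b_def)
  \<comment> \<open>The weights are chosen so that each of the two terms sums to
    \<open>a * b / 2\<close>; they make sense because both norms are positive.\<close>
  let ?R = "\<lambda>k. b / (2 * a) * (cmod (f k))\<^sup>2 + a / (2 * b) * (cmod (g k))\<^sup>2"
  have le: "cmod (f k * cnj (g k)) \<le> ?R k" for k
  proof -
    have "0 \<le> (b * cmod (f k) - a * cmod (g k))\<^sup>2 / (2 * a * b)"
      using pos by simp
    also have "\<dots> = ?R k - cmod (f k * cnj (g k))"
      using pos by (simp add: norm_mult field_simps power2_eq_square)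
    finally show ?thesis by simp
  qed
  have R: "integrable (count_space UNIV) ?R"
    using f g by (simp add: l2_integrable)
  then show int: "integrable (count_space UNIV) (\<lambda>k. f k * cnj (g k))"
  proof (rule Bochner_Integration.integrable_bound)
    show "AE k in count_space UNIV. norm (f k * cnj (g k)) \<le> norm (?R k)"
      unfolding real_norm_def by (intro AE_I2 order_trans[OF le abs_ge_self])
  qed simp
  have "(LINT k|count_space UNIV. cmod (f k * cnj (g k))) \<le> (LINT k|count_space UNIV. ?R k)"
    using int R by (intro integral_mono le integrable_norm)
  also have "\<dots> = b / (2 * a) * a\<^sup>2 + a / (2 * b) * b\<^sup>2"
    using f g by (simp add: l2_integrable a_def b_def integral_nonneg)
  also have "\<dots> = a * b"
    using pos by (simp add: field_simps power2_eq_square)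
  finally have "(LINT k|count_space UNIV. cmod (f k * cnj (g k)))\<^sup>2 \<le> (a * b)\<^sup>2"
    by (intro power_mono) (auto intro: integral_nonneg)
  also have "\<dots> = (LINT k|count_space UNIV. (cmod (f k))\<^sup>2) * (LINT k|count_space UNIV. (cmod (g k))\<^sup>2)"
    by (simp add: power_mult_distrib a_def b_def integral_nonneg)
  finally show "(LINT k|count_space UNIV. cmod (f k * cnj (g k)))\<^sup>2
      \<le> (LINT k|count_space UNIV. (cmod (f k))\<^sup>2) * (LINT k|count_space UNIV. (cmod (g k))\<^sup>2)" .
qed

section \<open>Measurability, uniform bound and orthogonality relation of the short-time Fourier
  transform\<close>

lemma
  fixes f g :: "int ^ 'n \<Rightarrow> complex"
  assumes f: "f \<in> l2" "f \<noteq> (\<lambda>_. 0)" and g: "g \<in> l2" "g \<noteq> (\<lambda>_. 0)"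
  defines "A \<equiv> (LINT k|count_space UNIV. (cmod (f k))\<^sup>2) * (LINT k|count_space UNIV. (cmod (g k))\<^sup>2)"
  shows stft_measurable: "stft g f \<in> borel_measurable tf_measure"
    and stft_bound: "(cmod (stft g f x))\<^sup>2 \<le> A"
    and stft_orthogonality: "(\<integral>\<^sup>+x. ennreal ((cmod (stft g f x))\<^sup>2) \<partial>tf_measure) = ennreal A"
proof -
  interpret T: finite_measure "torus_measure :: (real ^ 'n) measure" by (rule finite_measure_torus)
  interpret C: sigma_finite_measure "count_space UNIV :: (int ^ 'n) measure"
    by (rule sigma_finite_measure_count_space)
  let ?C = "count_space UNIV :: (int ^ 'n) measure"
  \<comment> \<open>For fixed \<open>m\<close>, the transform is the Fourier series in
    \<open>w\<close> with coefficients \<open>h m\<close>. These are absolutely summable by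
    Cauchy-Schwarz, so \<open>parseval_torus\<close> applies to each slice.\<close>
  define h where "h = (\<lambda>m k. f k * cnj (g (k - m)))"
  have nz: "(\<lambda>k. g (k - m)) \<noteq> (\<lambda>_. 0)" for m
    using g(2) by (metis add_diff_cancel_right')
  have h: "integrable ?C (h m)" for m
    unfolding h_def using f g nz by (intro l2_Cauchy_Schwarz(1)) (auto simp: l2_shift)
  have stft: "stft g f (m, w) = (LINT k|?C. h m k * torus_char k w)" for m w
  proof -
    \<comment> \<open>Absolute summability identifies the infinite sum in \<open>stft\<close> with
      an integral over counting measure.\<close>
    have "integrable ?C (\<lambda>k. h m k * torus_char k w)"
      using h[of m] by (rule Bochner_Integration.integrable_bound) (auto simp: norm_mult)
    then show ?thesis
      unfolding stft_torus_char h_def infsetsum_def[symmetric] abs_summable_on_def[symmetric]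
      by (simp add: infsetsum_infsum)
  qed
  show meas [measurable]: "stft g f \<in> borel_measurable tf_measure"
    unfolding tf_measure_def
    by (rule measurable_pair_measure_countable1) (auto simp: stft intro!: parseval_torus(1) h)
  show "(cmod (stft g f x))\<^sup>2 \<le> A"
  proof (cases x)
    case (Pair m w)
    have "cmod (stft g f x) \<le> (LINT k|?C. cmod (h m k))"
      unfolding Pair stft by (rule order_trans[OF integral_norm_bound]) (simp add: norm_mult)
    then have "(cmod (stft g f x))\<^sup>2 \<le> (LINT k|?C. cmod (h m k))\<^sup>2"
      by (intro power_mono) auto
    also have "\<dots> \<le> A"
      using l2_Cauchy_Schwarz(2)[OF f, of "\<lambda>k. g (k - m)"] g nz
      by (simp add: A_def h_def l2_shift)
    finally show ?thesis .
  qed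
  \<comment> \<open>Nonnegative integrals allow Tonelli without prior integrability: Parseval in
    \<open>w\<close> for each \<open>m\<close> leaves a double sum over \<open>m\<close> and
    \<open>k\<close>, whose order is then exchanged.\<close>
  have "(\<integral>\<^sup>+x. ennreal ((cmod (stft g f x))\<^sup>2) \<partial>tf_measure)
      = (\<integral>\<^sup>+m. \<integral>\<^sup>+w. ennreal ((cmod (stft g f (m, w)))\<^sup>2) \<partial>torus_measure \<partial>?C)"
    using meas unfolding tf_measure_def by (subst T.nn_integral_fst[symmetric]) auto
  also have "\<dots> = (\<integral>\<^sup>+m. \<integral>\<^sup>+k. ennreal ((cmod (h m k))\<^sup>2) \<partial>?C \<partial>?C)"
    by (simp add: stft parseval_torus(2) h)
  also have "\<dots> = (\<integral>\<^sup>+k. \<integral>\<^sup>+m. ennreal ((cmod (h m k))\<^sup>2) \<partial>?C \<partial>?C)"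
    by (rule nn_integral_count_space_nn_integral) auto
  also have "\<dots> = (\<integral>\<^sup>+k. ennreal ((cmod (f k))\<^sup>2) * ennreal (LINT m|?C. (cmod (g m))\<^sup>2) \<partial>?C)"
  proof (intro nn_integral_cong)
    fix k :: "int ^ 'n"
    \<comment> \<open>The reflection of \<open>m\<close> to \<open>k - m\<close> is its own inverse,
      so the sum over \<open>m\<close> is the squared norm of \<open>g\<close> for every
      \<open>k\<close>, and the double sum factors.\<close>
    have bij: "bij_betw (\<lambda>m. k - m) UNIV UNIV"
      by (rule bij_betw_byWitness[where f' = "\<lambda>m. k - m"]) auto
    have "(\<integral>\<^sup>+m. ennreal ((cmod (h m k))\<^sup>2) \<partial>?C)
        = ennreal ((cmod (f k))\<^sup>2) * (\<integral>\<^sup>+m. ennreal ((cmod (g (k - m)))\<^sup>2) \<partial>?C)"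
      by (simp add: h_def norm_mult power_mult_distrib ennreal_mult nn_integral_cmult)
    also have "(\<integral>\<^sup>+m. ennreal ((cmod (g (k - m)))\<^sup>2) \<partial>?C) = (\<integral>\<^sup>+m. ennreal ((cmod (g m))\<^sup>2) \<partial>?C)"
      by (rule nn_integral_bij_count_space[OF bij])
    also have "\<dots> = ennreal (LINT m|?C. (cmod (g m))\<^sup>2)"
      using g by (intro nn_integral_eq_integral) (auto simp: l2_integrable)
    finally show "(\<integral>\<^sup>+m. ennreal ((cmod (h m k))\<^sup>2) \<partial>?C)
        = ennreal ((cmod (f k))\<^sup>2) * ennreal (LINT m|?C. (cmod (g m))\<^sup>2)" .
  qed
  also have "\<dots> = ennreal A"
    using f by (simp add: nn_integral_multc nn_integral_eq_integral l2_integrable A_def ennreal_mult integral_nonneg)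
  finally show "(\<integral>\<^sup>+x. ennreal ((cmod (stft g f x))\<^sup>2) \<partial>tf_measure) = ennreal A" .
qed

section \<open>The lower bound for the measure of \<open>\<Sigma>\<close>\<close>

theorem theorem3p8:
  fixes f g :: "int ^ 'n \<Rightarrow> complex"
    and \<Sigma> :: "((int ^ 'n) \<times> (real ^ 'n)) set"
    and \<epsilon> :: real
  assumes "f \<in> l2" and "f \<noteq> (\<lambda>_. 0)"
    and "g \<in> l2" and "g \<noteq> (\<lambda>_. 0)"
    and "\<Sigma> \<in> sets tf_measure" and "emeasure tf_measure \<Sigma> < \<infinity>"
    and "0 \<le> \<epsilon>" and "\<epsilon> < 1"
    and "tf_concentrated \<epsilon> \<Sigma> (stft g f)"
  shows "\<forall>p::real. p > 2 \<longrightarrow> measure tf_measure \<Sigma> \<ge> (1 - \<epsilon>\<^sup>2) powr (p / (p - 2))"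
proof -
  define A where "A = (LINT k|count_space UNIV. (cmod (f k))\<^sup>2) * (LINT k|count_space UNIV. (cmod (g k))\<^sup>2)"
  let ?V = "\<lambda>x. (cmod (stft g f x))\<^sup>2"
  let ?U = "space tf_measure - \<Sigma>"
  note fg = assms(1-4)
  have A: "0 < A"
    unfolding A_def using fg by (simp add: l2_integral_pos)
  have [measurable]: "stft g f \<in> borel_measurable tf_measure" "\<Sigma> \<in> sets tf_measure"
    using stft_measurable[OF fg] assms(5) by auto
  \<comment> \<open>The finite nonnegative integral makes \<open>?V\<close> integrable, so
    \<open>L2_norm\<close> of the transform is the genuine value \<open>sqrt A\<close> and not the
    default 0.\<close>
  have V: "has_bochner_integral tf_measure ?V A"
    using stft_orthogonality[OF fg] A
    by (intro has_bochner_integral_nn_integral) (auto simp: A_def)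
  then have intV: "integrable tf_measure ?V" and VA: "integral\<^sup>L tf_measure ?V = A"
    by (auto simp: has_bochner_integral_iff)
  have int\<Sigma>: "integrable tf_measure (\<lambda>x. indicator \<Sigma> x * ?V x)"
    using integrable_mult_indicator[OF assms(5) intV] by simp
  have intU: "integrable tf_measure (\<lambda>x. indicator ?U x * ?V x)"
    using integrable_mult_indicator[OF _ intV, of ?U] by simp
  have "A = (LINT x|tf_measure. indicator \<Sigma> x * ?V x + indicator ?U x * ?V x)"
    unfolding VA[symmetric]
    by (intro Bochner_Integration.integral_cong) (auto simp: indicator_def)
  also have "\<dots> = (LINT x|tf_measure. indicator \<Sigma> x * ?V x) + (LINT x|tf_measure. indicator ?U x * ?V x)"
    by (rule Bochner_Integration.integral_add[OF int\<Sigma> intU])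
  \<comment> \<open>The pointwise bound \<open>stft_bound\<close> enters here; finiteness of the
    measure of \<open>\<Sigma>\<close> makes the constant \<open>A\<close> integrable over
    it.\<close>
  also have "(LINT x|tf_measure. indicator \<Sigma> x * ?V x) \<le> (LINT x|tf_measure. indicator \<Sigma> x * A)"
  proof (rule integral_mono[OF int\<Sigma>])
    show "integrable tf_measure (\<lambda>x. indicator \<Sigma> x * A)"
      using assms(5,6) by simp
  qed (use stft_bound[OF fg] in \<open>auto simp: A_def indicator_def\<close>)
  also have "\<dots> = measure tf_measure \<Sigma> * A"
    using assms(5) by (simp add: sets.Int_space_eq2)
  also have "(LINT x|tf_measure. indicator ?U x * ?V x) \<le> \<epsilon>\<^sup>2 * A"
  proof -
    \<comment> \<open>An indicator equals its own square, so it may move inside the squared modulus,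
      as in \<open>tf_concentrated\<close>.\<close>
    have "(LINT x|tf_measure. indicator ?U x * ?V x)
        = (LINT x|tf_measure. (cmod (indicator ?U x * stft g f x))\<^sup>2)"
      by (intro Bochner_Integration.integral_cong) (auto simp: indicator_def)
    then have "sqrt (LINT x|tf_measure. indicator ?U x * ?V x) \<le> \<epsilon> * sqrt A"
      using assms(9) by (simp add: tf_concentrated_def L2_norm_def VA)
    then have "sqrt (LINT x|tf_measure. indicator ?U x * ?V x) \<le> sqrt (\<epsilon>\<^sup>2 * A)"
      using assms(7) by (simp add: real_sqrt_mult)
    then show ?thesis by simp
  qed
  finally have "(1 - \<epsilon>\<^sup>2) * A \<le> measure tf_measure \<Sigma> * A"
    by (simp add: algebra_simps)
  then have bound: "1 - \<epsilon>\<^sup>2 \<le> measure tf_measure \<Sigma>"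
    using A by simp
  \<comment> \<open>With a base in (0, 1], raising the exponent from 1 to \<open>p / (p - 2)\<close>
    can only decrease the power.\<close>
  have \<epsilon>: "0 < 1 - \<epsilon>\<^sup>2" "1 - \<epsilon>\<^sup>2 \<le> 1"
    using assms(7,8) by (simp_all add: power_less_one_iff abs_square_less_1)
  show ?thesis
  proof (intro allI impI)
    fix p :: real
    assume "2 < p"
    then have "1 \<le> p / (p - 2)" by simp
    then have "(1 - \<epsilon>\<^sup>2) powr (p / (p - 2)) \<le> (1 - \<epsilon>\<^sup>2) powr 1"
      using \<epsilon> by (intro powr_mono') auto
    also have "\<dots> \<le> measure tf_measure \<Sigma>"
      using \<epsilon> bound by simp
    finally show "(1 - \<epsilon>\<^sup>2) powr (p / (p - 2)) \<le> measure tf_measure \<Sigma>" .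
  qed
qed

end
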